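(* For $k=2,\dots,8$ and $n=0,1,2,\dots$ we have $$\lambda_n^k<\lambda_{n+1}$$ (where $\lambda_n$, $\lambda_{n+1}$ are computed for that $k$), and hence $$h_n^{(k)}<h_{n+1}^{(k)}.$$ Moreover, $$\lim_{k\to\infty}h^{(k)}=\log2.$$
   Context: For an integer $k\ge2$, the $k$-tree is the set of finite words on $\{0,\dots,k-1\}$, with root the empty word, in which the children of $w$ are the nodes $ws$; $\Delta_n$ is the set of words of length at most $n$, so $|\Delta_n|=1+k+\dots+k^n$. A labeling by $\{0,1\}$ is legal if no two adjacent nodes (parent and child) are both labeled $1$. For $n\ge0$ let $B_n$, $B_n(0)$, $B_n(1)$ be the number of legal labelings of $\Delta_n$, respectively of those with $0$, respectively $1$, at the root; thus $B_0(0)=B_0(1)=1$, $B_{n+1}(0)=B_n^k$, $B_{n+1}(1)=B_n(0)^k$, $B_n=B_n(0)+B_n(1)$. Also set $B_{-1}(0)=1$, $B_{-1}(1)=0$, $B_{-1}=1$. The entropy of the golden mean shift of finite type on the $k$-tree is $h^{(k)}=\lim_{n\to\infty}\log B_n/|\Delta_n|$. For $n\ge-1$, $\lambda_n$ is the Perron–Frobenius (largest) eigenvalue of the matrix $\begin{bmatrix}B_n^{k-1}&B_n^{k-1}\\ B_n(0)^{k-1}&0\end{bmatrix}$, i.e. $\lambda_n=\tfrac12\left(B_n^{k-1}+\sqrt{B_n^{2k-2}+4[B_nB_n(0)]^{k-1}}\right)$. For $n\ge0$, the strip entropy is $h_n^{(k)}=\dfrac{\log\lambda_{n-1}}{k^n}$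 (the topological entropy, divided by $k^n$, of the one-dimensional shift of finite type of legal labelings of the left edge $\{0^i\}$ of the tree with $k-1$ translates of $\Delta_{n-1}$ attached at each node $0^i$, rooted at the children $0^is$, $s\neq0$). *)

theory Defs
  imports "HOL-Analysis.Analysis" "Jordan_Normal_Form.Spectral_Radius"
begin

text \<open>
  Nodes of the k-tree are words over \<open>{..<k}\<close>; the children of \<open>w\<close> are the words \<open>w @ [s]\<close>.
  The level \<open>n\<close> is an integer because the level \<open>-1\<close> (the empty tree) is used.
\<close>

definition Delta :: "nat \<Rightarrow> int \<Rightarrow> nat list set" where
  "Delta k n = {w. set w \<subseteq> {..<k} \<and> int (length w) \<le> n}"

definition legal :: "nat \<Rightarrow> int \<Rightarrow> (nat list \<Rightarrow> nat) set" where
  "legal k n = {f \<in> Delta k n \<rightarrow>\<^sub>E {0, 1}.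
     \<forall>w s. w \<in> Delta k n \<longrightarrow> w @ [s] \<in> Delta k n \<longrightarrow> \<not> (f w = 1 \<and> f (w @ [s]) = 1)}"

text \<open>For \<open>n = -1\<close> the only labeling is the empty one, so \<open>B k (-1) = 1\<close>.\<close>

definition B :: "nat \<Rightarrow> int \<Rightarrow> nat" where
  "B k n = card (legal k n)"

text \<open>
  \<open>B_root k n a\<close> counts the legal labelings with label \<open>a\<close> at the root. There is no root for
  \<open>n = -1\<close>, where the values 1 (for \<open>a = 0\<close>) and 0 (for \<open>a = 1\<close>) are set by convention.
\<close>

definition B_root :: "nat \<Rightarrow> int \<Rightarrow> nat \<Rightarrow> nat" where
  "B_root k n a =
     (if n = -1 then (if a = 0 then 1 else 0) else card {f \<in> legal k n. f [] = a})"

definition strip_matrix :: "nat \<Rightarrow> int \<Rightarrow> real mat" where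
  "strip_matrix k n = mat_of_rows_list 2
     [[real (B k n) ^ (k - 1), real (B k n) ^ (k - 1)],
      [real (B_root k n 0) ^ (k - 1), 0]]"

text \<open>
  Both eigenvalues of this matrix are real, so the largest element of its real spectrum is the
  Perron-Frobenius eigenvalue.
\<close>

definition lam :: "nat \<Rightarrow> int \<Rightarrow> real" where
  "lam k n = Max (spectrum (strip_matrix k n))"

definition strip_entropy :: "nat \<Rightarrow> nat \<Rightarrow> real" where
  "strip_entropy k n = ln (lam k (int n - 1)) / real k ^ n"

definition tree_entropy :: "nat \<Rightarrow> real" where
  "tree_entropy k = lim (\<lambda>n::nat. ln (real (B k (int n))) / real (card (Delta k (int n))))"

end

theory Submission
  imports Defs
begin

text \<open>
  Put \<open>p = B\<^sub>n(0) / B\<^sub>n\<close> and let \<open>\<mu>\<close> be the positive root of \<open>\<mu>\<^sup>2 = \<mu> + p\<^sup>k\<^sup>-\<^sup>1\<close>, so that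
  \<open>\<lambda>\<^sub>n = B\<^sub>n\<^sup>k\<^sup>-\<^sup>1 \<mu>\<close>. Eliminating the square root in \<open>\<lambda>\<^sub>n\<^sub>+\<^sub>1\<close>, the inequality \<open>\<lambda>\<^sub>n\<^sup>k < \<lambda>\<^sub>n\<^sub>+\<^sub>1\<close> becomes
  \<open>\<mu>\<^sup>2\<^sup>k < (1 + \<mu>\<^sup>k) (1 + p\<^sup>k)\<^sup>k\<^sup>-\<^sup>1\<close>. With \<open>t = 1/\<mu>\<close> and \<open>x = 1/(p\<mu>)\<close> this is
  \<open>(1 - t + t x\<^sup>1\<^sup>-\<^sup>k) (1 - t + t x)\<^sup>k\<^sup>-\<^sup>1 > 1\<close>, which is the weighted AM-GM inequality; it is strict
  unless \<open>x = 1\<close>, that is, unless \<open>p\<close> is the fixed point of \<open>p \<mapsto> 1/(1 + p\<^sup>k)\<close>. The orbit of \<open>1\<close>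
  never hits that fixed point because the map is injective.

  For the limit, \<open>B\<^sub>n\<^sup>k \<le> B\<^sub>n\<^sub>+\<^sub>1 \<le> 2 B\<^sub>n\<^sup>k\<close> gives \<open>(1 - 1/k) log 2 \<le> h\<^sup>(\<^sup>k\<^sup>) \<le> log 2\<close>.
\<close>

section \<open>Counting legal labelings\<close>

lemma Nil_in_Delta: "[] \<in> Delta k n \<longleftrightarrow> 0 \<le> n"
  by (simp add: Delta_def)

lemma Cons_in_Delta: "s # w \<in> Delta k (n + 1) \<longleftrightarrow> s < k \<and> w \<in> Delta k n"
  by (auto simp: Delta_def)

lemma Delta_0: "Delta k 0 = {[]}"
  by (auto simp: Delta_def)

lemma finite_Delta: "finite (Delta k n)"
proof (rule finite_subset)
  show "Delta k n \<subseteq> {w. set w \<subseteq> {..<k} \<and> length w \<le> nat n}"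
    by (auto simp: Delta_def)
qed (simp add: finite_lists_length_le)

text \<open>A word is empty or a first letter followed by a shorter word, so the tree is its root
  together with \<open>k\<close> copies of the tree one level lower. At \<open>n = -1\<close> the
  copies are empty.\<close>

lemma card_Delta_Suc:
  assumes "n \<ge> -1"
  shows "card (Delta k (n + 1)) = k * card (Delta k n) + 1"
proof -
  have split: "Delta k (n + 1) = insert [] ((\<lambda>(s, w). s # w) ` ({..<k} \<times> Delta k n))"
  proof (rule Set.set_eqI)
    fix w show "w \<in> Delta k (n + 1) \<longleftrightarrow>
        w \<in> insert [] ((\<lambda>(s, w). s # w) ` ({..<k} \<times> Delta k n))"
      using assms by (cases w) (auto simp: Nil_in_Delta Cons_in_Delta)
  qed
  have "card ((\<lambda>(s, w). s # w) ` ({..<k} \<times> Delta k n)) = k * card (Delta k n)"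
    by (subst card_image) (auto simp: inj_on_def card_cartesian_product)
  then show ?thesis
    unfolding split by (subst card_insert_disjoint) (auto simp: finite_Delta)
qed

section \<open>Decomposition of legal labelings at the root\<close>

lemma finite_legal: "finite (legal k n)"
  by (rule finite_subset[of _ "Delta k n \<rightarrow>\<^sub>E {0, 1}"])
    (auto simp: legal_def intro!: finite_PiE finite_Delta)

lemma legal_values: "f \<in> legal k n \<Longrightarrow> w \<in> Delta k n \<Longrightarrow> f w \<in> {0, 1}"
  by (auto simp: legal_def)

text \<open>Children are formed by appending at the end, so putting a letter \<open>s\<close> in
  front preserves adjacency. The only edges outside the subtrees are those from the root to the
  nodes \<open>[s]\<close>; the guard \<open>0 \<le> n\<close> is there because level 0 has no such
  nodes.\<close>

lemma legal_Suc_iff: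
  assumes "n \<ge> -1"
  shows "f \<in> legal k (n + 1) \<longleftrightarrow>
    f \<in> extensional (Delta k (n + 1)) \<and> f [] \<in> {0, 1} \<and>
    (\<forall>s<k. (\<lambda>w\<in>Delta k n. f (s # w)) \<in> legal k n \<and> (f [] = 1 \<longrightarrow> 0 \<le> n \<longrightarrow> f [s] \<noteq> 1))"
    (is "?L \<longleftrightarrow> ?R")
proof
  assume L: ?L
  have adj: "\<not> (f w = 1 \<and> f (w @ [s]) = 1)"
    if "w \<in> Delta k (n + 1)" "w @ [s] \<in> Delta k (n + 1)" for w s
    using L that by (auto simp: legal_def)
  have "(\<lambda>w\<in>Delta k n. f (s # w)) \<in> legal k n" if "s < k" for s
    unfolding legal_def
  proof (intro CollectI conjI allI impI)
    show "(\<lambda>w\<in>Delta k n. f (s # w)) \<in> Delta k n \<rightarrow>\<^sub>E {0, 1}"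
      using legal_values[OF L] that by (auto simp: Cons_in_Delta)
    fix w t assume "w \<in> Delta k n" "w @ [t] \<in> Delta k n"
    then show "\<not> ((\<lambda>w\<in>Delta k n. f (s # w)) w = 1 \<and> (\<lambda>w\<in>Delta k n. f (s # w)) (w @ [t]) = 1)"
      using adj[of "s # w" t] that by (simp add: Cons_in_Delta)
  qed
  moreover have "f [] = 1 \<longrightarrow> 0 \<le> n \<longrightarrow> f [s] \<noteq> 1" if "s < k" for s
    using adj[of "[]" s] that by (auto simp: Cons_in_Delta Nil_in_Delta)
  moreover have "f [] \<in> {0, 1}"
    using legal_values[OF L, of "[]"] assms by (simp add: Nil_in_Delta)
  ultimately show ?R
    using L by (auto simp: legal_def PiE_def)
next
  assume R: ?R
  have sub: "(\<lambda>w\<in>Delta k n. f (s # w)) \<in> legal k n" if "s < k" for s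
    using R that by blast
  show ?L
    unfolding legal_def
  proof (intro CollectI conjI allI impI)
    have "f w \<in> {0, 1}" if "w \<in> Delta k (n + 1)" for w
    proof (cases w)
      case Nil
      then show ?thesis using R by simp
    next
      case (Cons s v)
      then have "s < k" "v \<in> Delta k n" using that by (auto simp: Cons_in_Delta)
      then show ?thesis using legal_values[OF sub, of s v] Cons by simp
    qed
    then show "f \<in> Delta k (n + 1) \<rightarrow>\<^sub>E {0, 1}"
      using R by (auto simp: PiE_def)
    fix w t assume w: "w \<in> Delta k (n + 1)" "w @ [t] \<in> Delta k (n + 1)"
    show "\<not> (f w = 1 \<and> f (w @ [t]) = 1)"
    proof (cases w)
      case Nil
      then show ?thesis using R w by (auto simp: Cons_in_Delta Nil_in_Delta)
    next
      case (Cons s v)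
      then have "s < k" "v \<in> Delta k n" "v @ [t] \<in> Delta k n"
        using w by (auto simp: Cons_in_Delta)
      then show ?thesis using sub[of s] Cons by (auto simp: legal_def)
    qed
  qed
qed

text \<open>A labeling with a fixed root label is an arbitrary choice of \<open>k\<close> subtree
  labelings, each avoiding 1 at its own root when \<open>b = 1\<close>. One condition covers both
  values of \<open>b\<close>.\<close>

lemma card_legal_root:
  assumes n: "n \<ge> -1" and b: "b \<in> {0, 1}"
  shows "card {f \<in> legal k (n + 1). f [] = b} =
    card {g \<in> legal k n. b = 1 \<longrightarrow> 0 \<le> n \<longrightarrow> g [] \<noteq> 1} ^ k"
proof -
  define T where "T = {g \<in> legal k n. b = 1 \<longrightarrow> 0 \<le> n \<longrightarrow> g [] \<noteq> 1}"
  \<comment> \<open>Both levels are restricted to their domains, so that labelings correspond to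
    elements of an extensional function space and \<open>join\<close> inverts \<open>split\<close>
    exactly.\<close>
  define split where "split f = (\<lambda>s\<in>{..<k}. \<lambda>w\<in>Delta k n. f (s # w))" for f :: "nat list \<Rightarrow> nat"
  define join where
    "join h = (\<lambda>w\<in>Delta k (n + 1). case w of [] \<Rightarrow> b | s # v \<Rightarrow> h s v)"
    for h :: "nat \<Rightarrow> nat list \<Rightarrow> nat"
  have join_Nil: "join h [] = b" for h
    using n by (simp add: join_def Nil_in_Delta)
  have join_Cons: "join h (s # v) = h s v" if "s < k" "v \<in> Delta k n" for h s v
    using that by (simp add: join_def Cons_in_Delta)
  have ext: "g \<in> extensional (Delta k n)" if "g \<in> T" for g
    using that by (auto simp: T_def legal_def PiE_def)
  have sub_join: "(\<lambda>w\<in>Delta k n. join h (s # w)) = h s"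
    if "h \<in> {..<k} \<rightarrow>\<^sub>E T" "s < k" for h s
  proof (rule extensionalityI[OF restrict_extensional])
    show "h s \<in> extensional (Delta k n)" using that ext by auto
  qed (use that join_Cons in auto)
  have "bij_betw split {f \<in> legal k (n + 1). f [] = b} ({..<k} \<rightarrow>\<^sub>E T)"
  proof (rule bij_betw_byWitness[where f' = join])
    show "\<forall>f\<in>{f \<in> legal k (n + 1). f [] = b}. join (split f) = f"
    proof
      fix f assume f: "f \<in> {f \<in> legal k (n + 1). f [] = b}"
      show "join (split f) = f"
      proof (rule extensionalityI)
        show "join (split f) \<in> extensional (Delta k (n + 1))" by (simp add: join_def)
        show "f \<in> extensional (Delta k (n + 1))" using f by (auto simp: legal_def PiE_def)
        fix w assume "w \<in> Delta k (n + 1)"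
        then show "join (split f) w = f w"
          using f by (cases w) (auto simp: join_Nil join_Cons Cons_in_Delta split_def)
      qed
    qed
    show "\<forall>h\<in>{..<k} \<rightarrow>\<^sub>E T. split (join h) = h"
    proof
      fix h assume h: "h \<in> {..<k} \<rightarrow>\<^sub>E T"
      show "split (join h) = h"
        by (rule extensionalityI[of _ "{..<k}"])
          (use h sub_join in \<open>auto simp: split_def PiE_def\<close>)
    qed
    show "split ` {f \<in> legal k (n + 1). f [] = b} \<subseteq> {..<k} \<rightarrow>\<^sub>E T"
      unfolding split_def T_def by (auto simp: legal_Suc_iff[OF n] Nil_in_Delta)
    show "join ` ({..<k} \<rightarrow>\<^sub>E T) \<subseteq> {f \<in> legal k (n + 1). f [] = b}"
    proof (rule image_subsetI)
      fix h assume h: "h \<in> {..<k} \<rightarrow>\<^sub>E T"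
      then have hs: "h s \<in> T" if "s < k" for s using that by auto
      have "join h \<in> legal k (n + 1)"
        unfolding legal_Suc_iff[OF n]
      proof (intro conjI allI impI)
        show "join h \<in> extensional (Delta k (n + 1))" by (simp add: join_def)
        show "join h [] \<in> {0, 1}" using b by (simp add: join_Nil)
        fix s assume s: "s < k"
        show "(\<lambda>w\<in>Delta k n. join h (s # w)) \<in> legal k n"
          using sub_join[OF h s] hs[OF s] by (simp add: T_def)
        assume "join h [] = 1" "0 \<le> n"
        then show "join h [s] \<noteq> 1"
          using hs[OF s] s by (simp add: join_Nil join_Cons Nil_in_Delta T_def)
      qed
      then show "join h \<in> {f \<in> legal k (n + 1). f [] = b}" by (simp add: join_Nil)
    qed
  qed
  from bij_betw_same_card[OF this] show ?thesis
    by (simp add: card_PiE T_def)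
qed

text \<open>At level -1 the guard is vacuous and the single empty labeling is counted, which agrees
  with the convention for \<open>B_root\<close>. Hence the recursion for \<open>B\<close> holds from
  \<open>n = -1\<close> on.\<close>

lemma B_root_0_eq_card:
  assumes "n \<ge> -1"
  shows "card {g \<in> legal k n. 0 \<le> n \<longrightarrow> g [] \<noteq> 1} = B_root k n 0"
proof (cases "n = -1")
  case True
  then have "Delta k n = {}" by (auto simp: Delta_def)
  then have "{g \<in> legal k n. 0 \<le> n \<longrightarrow> g [] \<noteq> 1} = {\<lambda>_. undefined}"
    using True by (auto simp: legal_def)
  then show ?thesis using True by (simp add: B_root_def)
next
  case False
  then have "0 \<le> n" using assms by simp
  then have "{g \<in> legal k n. 0 \<le> n \<longrightarrow> g [] \<noteq> 1} = {g \<in> legal k n. g [] = 0}"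
    using legal_values[of _ k n "[]"] by (auto simp: Nil_in_Delta)
  then show ?thesis using False by (simp add: B_root_def)
qed

lemma B_root_0_Suc: "n \<ge> -1 \<Longrightarrow> B_root k (n + 1) 0 = B k n ^ k"
  using card_legal_root[of n 0 k] by (simp add: B_root_def B_def)

lemma B_Suc:
  assumes "n \<ge> -1"
  shows "B k (n + 1) = B k n ^ k + B_root k n 0 ^ k"
proof -
  have "legal k (n + 1) = {f \<in> legal k (n + 1). f [] = 0} \<union> {f \<in> legal k (n + 1). f [] = 1}"
    using assms legal_values[of _ k "n + 1" "[]"] by (auto simp: Nil_in_Delta)
  then have "B k (n + 1) =
      card {f \<in> legal k (n + 1). f [] = 0} + card {f \<in> legal k (n + 1). f [] = 1}"
    unfolding B_def by (metis (mono_tags, lifting) card_Un_disjoint disjoint_iff finite_Un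
        finite_legal mem_Collect_eq zero_neq_one)
  then show ?thesis
    using card_legal_root[OF assms, of 0 k] card_legal_root[OF assms, of 1 k]
      B_root_0_eq_card[OF assms, of k]
    by (simp add: B_def)
qed

lemma B_minus_1: "B k (-1) = 1"
proof -
  have "Delta k (-1) = {}" by (auto simp: Delta_def)
  then have "legal k (-1) = {\<lambda>_. undefined}" by (auto simp: legal_def)
  then show ?thesis by (simp add: B_def)
qed

lemma B_root_0_minus_1: "B_root k (-1) 0 = 1"
  by (simp add: B_root_def)

lemma B_pos_and_B_root_0_pos:
  assumes "n \<ge> -1"
  shows "B k n > 0 \<and> B_root k n 0 > 0"
  using assms
  by (induction n rule: int_ge_induct) (simp_all add: B_minus_1 B_root_0_minus_1 B_Suc B_root_0_Suc)

section \<open>The ratio of labelings with 0 at the root\<close>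

text \<open>For \<open>n \<ge> 0\<close> this is the probability of 0 at the root of a uniformly
  chosen legal labeling; the orbit starts with the value 1 at level -1.\<close>

definition zero_ratio :: "nat \<Rightarrow> int \<Rightarrow> real" where
  "zero_ratio k n = real (B_root k n 0) / real (B k n)"

lemma zero_ratio_pos: "n \<ge> -1 \<Longrightarrow> zero_ratio k n > 0"
  using B_pos_and_B_root_0_pos[of n k] by (simp add: zero_ratio_def)

lemma B_root_0_ratio:
  "n \<ge> -1 \<Longrightarrow> real (B_root k n 0) = real (B k n) * zero_ratio k n"
  using B_pos_and_B_root_0_pos[of n k] by (simp add: zero_ratio_def)

lemma B_Suc_ratio:
  assumes "n \<ge> -1"
  shows "real (B k (n + 1)) = real (B k n) ^ k * (1 + zero_ratio k n ^ k)"
  by (simp add: B_Suc[OF assms] B_root_0_ratio[OF assms] power_mult_distrib distrib_left)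

lemma zero_ratio_Suc:
  assumes "n \<ge> -1"
  shows "zero_ratio k (n + 1) = 1 / (1 + zero_ratio k n ^ k)"
proof -
  have "zero_ratio k (n + 1) = real (B k n) ^ k / (real (B k n) ^ k * (1 + zero_ratio k n ^ k))"
    using B_Suc_ratio[OF assms, of k]
    by (subst zero_ratio_def) (simp add: B_root_0_Suc[OF assms])
  then show ?thesis
    using B_pos_and_B_root_0_pos[OF assms, of k] by simp
qed

lemma zero_ratio_le_1:
  assumes "n \<ge> -1"
  shows "zero_ratio k n \<le> 1"
  using assms
proof (induction n rule: int_ge_induct)
  case base
  show ?case by (simp add: zero_ratio_def B_minus_1 B_root_0_minus_1)
next
  case (step n)
  have "1 + zero_ratio k n ^ k \<ge> 1" using zero_ratio_pos[OF step.hyps, of k] by simp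
  then show ?case using step by (simp add: zero_ratio_Suc)
qed

text \<open>The excluded equation says that the ratio is a fixed point of
  \<open>p \<mapsto> 1 / (1 + p ^ k)\<close>. If one term of the orbit were fixed, injectivity would
  make its predecessor equal to it, and so on back to the starting value 1, which is not
  fixed.\<close>

lemma zero_ratio_not_fixed:
  assumes "n \<ge> -1" and k: "k \<ge> 1"
  shows "zero_ratio k n + zero_ratio k n ^ (k + 1) \<noteq> 1"
  using assms(1)
proof (induction n rule: int_ge_induct)
  case base
  show ?case by (simp add: zero_ratio_def B_minus_1 B_root_0_minus_1)
next
  case (step n)
  define p q where "p = zero_ratio k n" and "q = zero_ratio k (n + 1)"
  have pos: "p > 0" "q > 0"
    using zero_ratio_pos[of n k] zero_ratio_pos[of "n + 1" k] step.hyps by (auto simp: p_def q_def)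
  have "1 + p ^ k > 0" using pos by (simp add: add_pos_pos)
  then have "q * (1 + p ^ k) = 1"
    using zero_ratio_Suc[OF step.hyps, of k] unfolding p_def q_def by simp
  moreover have "p = q" if "q * (1 + q ^ k) = 1"
  proof -
    have "q * (1 + p ^ k) = q * (1 + q ^ k)" using calculation that by (simp only:)
    then have "p ^ k = q ^ k" using pos by (simp only: mult_cancel_left) simp
    then show "p = q" using pos k by (simp add: power_eq_iff_eq_base)
  qed
  ultimately show ?case
    using step.IH unfolding p_def[symmetric] q_def[symmetric] by (auto simp: algebra_simps)
qed

section \<open>The Perron-Frobenius eigenvalue\<close>

text \<open>For \<open>u \<ge> 0\<close>, the larger root of \<open>x ^ 2 = x + u\<close>. It is the
  Perron-Frobenius eigenvalue after division by \<open>B k n ^ (k - 1)\<close>.\<close>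

definition pf_root :: "real \<Rightarrow> real" where
  "pf_root u = (1 + sqrt (1 + 4 * u)) / 2"

lemma pf_root_gt_1: "u > 0 \<Longrightarrow> pf_root u > 1"
  by (simp add: pf_root_def)

lemma pf_root_square: "u \<ge> 0 \<Longrightarrow> pf_root u ^ 2 = pf_root u + u"
  by (simp add: pf_root_def power2_eq_square field_simps)

text \<open>The function \<open>x * (x - 1)\<close> increases for \<open>x \<ge> 1\<close> and
  equals \<open>u\<close> at the root. This turns a lower bound on an eigenvalue into an inequality
  without square roots.\<close>

lemma less_pf_root:
  assumes "u > 0" "x ^ 2 < x + u"
  shows "x < pf_root u"
proof (rule ccontr)
  assume "\<not> x < pf_root u"
  then have "x \<ge> pf_root u" "pf_root u > 1" using pf_root_gt_1[OF assms(1)] by auto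
  then have "pf_root u * (pf_root u - 1) \<le> x * (x - 1)" by (intro mult_mono) auto
  then show False
    using assms pf_root_square[of u] by (simp add: power2_eq_square algebra_simps)
qed

text \<open>The right-hand side is the characteristic equation, obtained here directly from the two
  coordinates of the eigenvector equation.\<close>

lemma eigenvalue_2x2:
  fixes b c x :: real
  assumes "c \<noteq> 0"
  shows "eigenvalue (mat_of_rows_list 2 [[b, b], [c, 0]]) x \<longleftrightarrow> x ^ 2 = b * x + b * c"
proof -
  let ?A = "mat_of_rows_list 2 [[b, b], [c, 0]]"
  have dim: "dim_row ?A = 2" "dim_col ?A = 2" by (simp_all add: mat_of_rows_list_def)
  have ev: "eigenvector ?A v x \<longleftrightarrow>
      (Matrix.vec_index v 0 \<noteq> 0 \<or> Matrix.vec_index v 1 \<noteq> 0) \<and>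
      b * Matrix.vec_index v 0 + b * Matrix.vec_index v 1 = x * Matrix.vec_index v 0 \<and>
      c * Matrix.vec_index v 0 = x * Matrix.vec_index v 1"
    if v: "dim_vec v = 2" for v
  proof -
    have eq2: "u = w \<longleftrightarrow> Matrix.vec_index u 0 = Matrix.vec_index w 0 \<and>
        Matrix.vec_index u 1 = Matrix.vec_index w 1"
      if "dim_vec u = 2" "dim_vec w = 2" for u w :: "real Matrix.vec"
      using that by (auto simp: Matrix.vec_eq_iff less_2_cases_iff)
    have sum2: "(\<Sum>i = 0..<2. g i) = g 0 + g (1::nat)" for g :: "nat \<Rightarrow> real"
      by (simp add: numeral_2_eq_2)
    have Av: "Matrix.vec_index (?A *\<^sub>v v) 0 = b * Matrix.vec_index v 0 + b * Matrix.vec_index v 1"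
      "Matrix.vec_index (?A *\<^sub>v v) 1 = c * Matrix.vec_index v 0"
      using v by (simp_all add: mat_of_rows_list_def scalar_prod_def sum2)
    have "?A *\<^sub>v v = x \<cdot>\<^sub>v v \<longleftrightarrow>
        b * Matrix.vec_index v 0 + b * Matrix.vec_index v 1 = x * Matrix.vec_index v 0 \<and>
        c * Matrix.vec_index v 0 = x * Matrix.vec_index v 1"
    proof (subst eq2)
      show "dim_vec (?A *\<^sub>v v) = 2" "dim_vec (x \<cdot>\<^sub>v v) = 2"
        using v dim by simp_all
      show "(Matrix.vec_index (?A *\<^sub>v v) 0 = Matrix.vec_index (x \<cdot>\<^sub>v v) 0 \<and>
          Matrix.vec_index (?A *\<^sub>v v) 1 = Matrix.vec_index (x \<cdot>\<^sub>v v) 1) =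
        (b * Matrix.vec_index v 0 + b * Matrix.vec_index v 1 = x * Matrix.vec_index v 0 \<and>
          c * Matrix.vec_index v 0 = x * Matrix.vec_index v 1)"
        unfolding Av using v by simp
    qed
    moreover have "v = 0\<^sub>v 2 \<longleftrightarrow> Matrix.vec_index v 0 = 0 \<and> Matrix.vec_index v 1 = 0"
      using v by (subst eq2) simp_all
    moreover have "v \<in> carrier_vec 2" using v by (rule carrier_vecI)
    ultimately show ?thesis
      unfolding eigenvector_def dim by blast
  qed
  show ?thesis
  proof
    assume "eigenvalue ?A x"
    then obtain v where v: "eigenvector ?A v x" by (auto simp: eigenvalue_def)
    then have "dim_vec v = 2" using dim carrier_vecD by (metis eigenvector_def)
    from v[unfolded ev[OF this]] obtain y z where yz:
      "y \<noteq> 0 \<or> z \<noteq> 0" "b * y + b * z = x * y" "c * y = x * z" by blast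
    show "x ^ 2 = b * x + b * c"
    proof (cases "y = 0")
      \<comment> \<open>Now \<open>z \<noteq> 0\<close>, so the two coordinate equations force both
        \<open>b\<close> and \<open>x\<close> to vanish.\<close>
      case True
      then show ?thesis using yz by simp
    next
      case False
      have "x ^ 2 * y = x * (b * y + b * z)" by (simp add: yz(2) power2_eq_square)
      also have "\<dots> = b * x * y + b * (x * z)" by (simp add: algebra_simps)
      also have "\<dots> = (b * x + b * c) * y" by (simp add: yz(3)[symmetric] algebra_simps)
      finally show ?thesis using False by simp
    qed
  next
    assume x: "x ^ 2 = b * x + b * c"
    \<comment> \<open>The vector with entries \<open>x\<close> and \<open>c\<close> satisfies the
      second row identically and the first row by the quadratic equation; it is nonzero since
      \<open>c \<noteq> 0\<close>.\<close>
    have "eigenvector ?A (Matrix.vec 2 (\<lambda>i. if i = 0 then x else c)) x"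
      by (subst ev) (use x assms in \<open>auto simp: power2_eq_square\<close>)
    then show "eigenvalue ?A x" by (auto simp: eigenvalue_def)
  qed
qed

text \<open>With \<open>c = b * u\<close>, rescaling an eigenvalue by \<open>b\<close> turns the
  characteristic equation into the equation defining \<open>pf_root u\<close>.\<close>

lemma lam_eq:
  assumes "n \<ge> -1"
  shows "lam k n = real (B k n) ^ (k - 1) * pf_root (zero_ratio k n ^ (k - 1))"
proof -
  define b c where "b = real (B k n) ^ (k - 1)" and "c = real (B_root k n 0) ^ (k - 1)"
  have pos: "b > 0" "c > 0"
    using B_pos_and_B_root_0_pos[OF assms, of k] by (auto simp: b_def c_def)
  define u where "u = zero_ratio k n ^ (k - 1)"
  have u: "c = b * u" by (simp add: u_def b_def c_def B_root_0_ratio[OF assms] power_mult_distrib)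
  then have "u > 0" using pos by (simp add: zero_less_mult_iff)
  note sq = pf_root_square[OF less_imp_le[OF \<open>u > 0\<close>]]
  \<comment> \<open>The two rescaled roots sum to 1, which gives \<open>1 - pf_root u\<close> as the
    other one.\<close>
  have roots: "x ^ 2 = b * x + b * c \<longleftrightarrow> x = b * pf_root u \<or> x = b * (1 - pf_root u)" for x
  proof -
    have "(x - b * pf_root u) * (x - b * (1 - pf_root u)) =
        x ^ 2 - b * x + b ^ 2 * (pf_root u - pf_root u ^ 2)"
      by (simp add: power2_eq_square algebra_simps)
    then have "x ^ 2 - (b * x + b * c) = (x - b * pf_root u) * (x - b * (1 - pf_root u))"
      unfolding sq u by (simp add: power2_eq_square)
    then show ?thesis by (metis eq_iff_diff_eq_0 mult_eq_0_iff)
  qed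
  have "strip_matrix k n = mat_of_rows_list 2 [[b, b], [c, 0]]"
    by (simp only: strip_matrix_def b_def c_def)
  moreover have "eigenvalue (mat_of_rows_list 2 [[b, b], [c, 0]]) x \<longleftrightarrow>
      x = b * pf_root u \<or> x = b * (1 - pf_root u)" for x
    by (subst eigenvalue_2x2) (use pos roots in blast)+
  ultimately have "spectrum (strip_matrix k n) = {b * pf_root u, b * (1 - pf_root u)}"
    unfolding spectrum_def by auto
  moreover have "b * (1 - pf_root u) \<le> b * pf_root u"
    using pos pf_root_gt_1[OF \<open>u > 0\<close>] by simp
  ultimately show ?thesis by (simp add: lam_def b_def u_def)
qed

lemma lam_pos:
  assumes "n \<ge> -1"
  shows "lam k n > 0"
  using B_pos_and_B_root_0_pos[OF assms, of k] zero_ratio_pos[OF assms, of k]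
    pf_root_gt_1[of "zero_ratio k n ^ (k - 1)"]
  by (simp add: lam_eq[OF assms])

section \<open>Monotonicity of the strip entropies\<close>

lemma ln_less_minus_one:
  fixes z :: real
  assumes "z > 0" "z \<noteq> 1"
  shows "ln z < z - 1"
  using ln_le_minus_one[OF assms(1)] ln_eq_minus_one[OF assms(1)] assms(2) by fastforce

text \<open>Strict concavity of \<open>ln\<close> at the points 1 and \<open>x\<close> with weights
  \<open>1 - t\<close> and \<open>t\<close>. The bound \<open>ln z \<le> z - 1\<close> is applied to
  both points divided by their mean \<open>A\<close>; the weighted linear terms then sum to
  0.\<close>

lemma weighted_ln_strict:
  fixes t x :: real
  assumes t: "0 < t" "t < 1" and x: "x > 0" "x \<noteq> 1"
  shows "t * ln x < ln (1 - t + t * x)"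
proof -
  define A where "A = 1 - t + t * x"
  have A: "A > 0" using t x by (simp add: A_def add_pos_pos)
  have "A - x = (1 - t) * (1 - x)" by (simp add: A_def algebra_simps)
  then have "x \<noteq> A" using t x by auto
  have "t * ln (x / A) < t * (x / A - 1)"
    using t x A \<open>x \<noteq> A\<close> by (intro mult_strict_left_mono ln_less_minus_one) auto
  moreover have "(1 - t) * ln (1 / A) \<le> (1 - t) * (1 / A - 1)"
    using t A by (intro mult_left_mono ln_le_minus_one) auto
  moreover have "t * (x / A - 1) + (1 - t) * (1 / A - 1) = (1 - t + t * x) / A - 1"
    using A by (simp add: field_simps)
  ultimately have "t * ln (x / A) + (1 - t) * ln (1 / A) < 0"
    using A by (simp add: A_def[symmetric])
  then have "t * ln x < ln A"
    using A x by (simp add: ln_div algebra_simps)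
  then show ?thesis by (simp only: A_def)
qed

text \<open>The concavity bound is used once at \<open>1 / x ^ m\<close> and \<open>m\<close> times
  at \<open>x\<close>; the logarithms on the smaller side cancel. Strictness is taken from the first
  use, where \<open>m \<ge> 1\<close> ensures \<open>1 / x ^ m \<noteq> 1\<close>.\<close>

lemma weighted_amgm_strict:
  fixes t x :: real
  assumes t: "0 < t" "t < 1" and x: "x > 0" "x \<noteq> 1" and m: "m \<ge> 1"
  shows "1 < (1 - t + t * (1 / x ^ m)) * (1 - t + t * x) ^ m"
proof -
  have pos: "1 - t + t * x > 0" "1 - t + t * (1 / x ^ m) > 0"
    using t x by (auto intro!: add_pos_pos)
  have xm: "1 / x ^ m > 0" "1 / x ^ m \<noteq> 1"
    using x m power_eq_iff_eq_base[of m x 1] by auto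
  have "t * ln (1 / x ^ m) + m * (t * ln x) = 0"
    using x by (simp add: ln_div ln_realpow)
  moreover have "m * (t * ln x) \<le> m * ln (1 - t + t * x)"
    using weighted_ln_strict[OF t x] by (intro mult_left_mono) auto
  ultimately have "0 < ln (1 - t + t * (1 / x ^ m)) + m * ln (1 - t + t * x)"
    using weighted_ln_strict[OF t xm] by linarith
  also have "\<dots> = ln ((1 - t + t * (1 / x ^ m)) * (1 - t + t * x) ^ m)"
    using pos by (simp add: ln_mult ln_realpow)
  finally show ?thesis
    using pos by (subst (asm) ln_gt_zero_iff) auto
qed

section \<open>The polynomial inequality and its transfer to eigenvalues\<close>

text \<open>Here \<open>m\<close> stands for \<open>k - 1\<close>, and
  \<open>p * \<mu> \<noteq> 1\<close> is the strictness condition \<open>x \<noteq> 1\<close> of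
  AM-GM with weight \<open>1 / \<mu>\<close>.\<close>

lemma pf_root_power_bound:
  fixes p \<mu> :: real
  assumes p: "p > 0" and \<mu>: "\<mu> > 1" "\<mu> ^ 2 = \<mu> + p ^ m" and m: "m \<ge> 1" and ne: "p * \<mu> \<noteq> 1"
  shows "\<mu> ^ (2 * (m + 1)) < (1 + \<mu> ^ (m + 1)) * (1 + p ^ (m + 1)) ^ m"
proof -
  define x where "x = 1 / (p * \<mu>)"
  have x: "x > 0" "x \<noteq> 1" using p \<mu> ne by (auto simp: x_def)
  \<comment> \<open>Used from right to left: collecting \<open>\<mu> * (\<mu> - 1)\<close> in both
    AM-GM factors and replacing it by \<open>p ^ m\<close> makes each factor a simple
    quotient.\<close>
  have pm: "p ^ m = \<mu> * (\<mu> - 1)" using \<mu>(2) by (simp add: power2_eq_square algebra_simps)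
  have "1 - 1 / \<mu> + 1 / \<mu> * (1 / x ^ m) = (\<mu> * (\<mu> - 1) + \<mu> * (p ^ m * \<mu> ^ m)) / \<mu> ^ 2"
    using \<mu>(1) p by (simp add: x_def power_divide power_mult_distrib power2_eq_square field_simps)
  also have "\<dots> = p ^ m * (1 + \<mu> ^ (m + 1)) / \<mu> ^ 2"
    unfolding pm[symmetric] by (simp add: algebra_simps)
  finally have 1: "1 - 1 / \<mu> + 1 / \<mu> * (1 / x ^ m) = p ^ m * (1 + \<mu> ^ (m + 1)) / \<mu> ^ 2" .
  have "1 - 1 / \<mu> + 1 / \<mu> * x = (1 + p * (\<mu> * (\<mu> - 1))) / (p * \<mu> ^ 2)"
    using \<mu>(1) p by (simp add: x_def power2_eq_square field_simps)
  also have "\<dots> = (1 + p ^ (m + 1)) / (p * \<mu> ^ 2)"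
    unfolding pm[symmetric] by simp
  finally have 2: "1 - 1 / \<mu> + 1 / \<mu> * x = (1 + p ^ (m + 1)) / (p * \<mu> ^ 2)" .
  have "1 < p ^ m * (1 + \<mu> ^ (m + 1)) / \<mu> ^ 2 * ((1 + p ^ (m + 1)) / (p * \<mu> ^ 2)) ^ m"
    using weighted_amgm_strict[OF _ _ x m, of "1 / \<mu>"] \<mu>(1) unfolding 1 2 by simp
  \<comment> \<open>The \<open>p ^ m\<close> from the first factor cancels the one in the
    denominator of the \<open>m\<close>-th power.\<close>
  also have "\<dots> = (1 + \<mu> ^ (m + 1)) * (1 + p ^ (m + 1)) ^ m / (\<mu> ^ 2 * (\<mu> ^ 2) ^ m)"
    using p by (simp add: power_divide power_mult_distrib)
  also have "\<mu> ^ 2 * (\<mu> ^ 2) ^ m = \<mu> ^ (2 * (m + 1))"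
    by (simp add: power_mult[symmetric] power_add[symmetric])
  finally show ?thesis
    using \<mu>(1) by simp
qed

text \<open>Since \<open>B k (n + 1)\<close> is \<open>B k n ^ k * (1 + p ^ k)\<close>, both sides
  share the factor \<open>(b ^ k) ^ m\<close>. What remains compares \<open>\<mu> ^ k\<close> with a
  multiple of \<open>pf_root (q ^ m)\<close>, where \<open>q\<close> is the next ratio.\<close>

lemma lam_power_less:
  assumes n: "n \<ge> -1" and k: "k \<ge> 2"
  shows "lam k n ^ k < lam k (n + 1)"
proof -
  obtain m where m: "k = m + 1" "m \<ge> 1" using k that[of "k - 1"] by simp
  define b p q \<mu> where "b = real (B k n)" and "p = zero_ratio k n"
    and "q = 1 / (1 + p ^ k)" and "\<mu> = pf_root (p ^ m)"
  have b: "b > 0" using B_pos_and_B_root_0_pos[OF n, of k] by (simp add: b_def)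
  have p: "p > 0" using zero_ratio_pos[OF n] by (simp add: p_def)
  have q: "q > 0" using p by (simp add: q_def add_pos_pos)
  have \<mu>: "\<mu> > 1" "\<mu> ^ 2 = \<mu> + p ^ m"
    using p by (auto simp: \<mu>_def pf_root_gt_1 pf_root_square)
  have "p * \<mu> \<noteq> 1"
  proof
    assume 1: "p * \<mu> = 1"
    \<comment> \<open>Multiplying the equation for \<open>\<mu>\<close> by \<open>p ^ 2\<close> and
      using \<open>p * \<mu> = 1\<close> gives \<open>1 = p + p ^ (m + 2)\<close>, the fixed-point
      equation because \<open>m + 2 = k + 1\<close>.\<close>
    have "p ^ 2 * \<mu> ^ 2 = p * (p * \<mu>) + p ^ (m + 2)"
      unfolding \<mu>(2) by (simp add: power2_eq_square algebra_simps)
    then have "p + p ^ (k + 1) = 1"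
      using 1 m by (simp add: power_mult_distrib[symmetric])
    then show False using zero_ratio_not_fixed[OF n, of k] k by (simp add: p_def)
  qed
  from pf_root_power_bound[OF p \<mu> m(2) this]
  have main: "\<mu> ^ (2 * k) < (1 + \<mu> ^ k) * (1 + p ^ k) ^ m" by (simp add: m)
  have s: "1 + p ^ k > 0" using p by (simp add: add_pos_pos)
  have "\<mu> ^ k / (1 + p ^ k) ^ m < pf_root (q ^ m)"
  proof (rule less_pf_root)
    show "q ^ m > 0" using q by simp
    have "(\<mu> ^ k / (1 + p ^ k) ^ m) ^ 2 = \<mu> ^ (2 * k) / (1 + p ^ k) ^ m / (1 + p ^ k) ^ m"
      by (simp add: power_divide power_mult[symmetric] power2_eq_square power_add[symmetric] mult_2_right
          mult.commute[of 2])
    also have "\<dots> < (1 + \<mu> ^ k) / (1 + p ^ k) ^ m"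
      using main s by (intro divide_strict_right_mono) (auto simp: pos_divide_less_eq)
    also have "\<dots> = \<mu> ^ k / (1 + p ^ k) ^ m + q ^ m"
      by (simp add: q_def power_divide add_divide_distrib)
    finally show "(\<mu> ^ k / (1 + p ^ k) ^ m) ^ 2 < \<mu> ^ k / (1 + p ^ k) ^ m + q ^ m" .
  qed
  then have "\<mu> ^ k < (1 + p ^ k) ^ m * pf_root (q ^ m)"
    using s by (simp add: pos_divide_less_eq mult.commute)
  then have "(b ^ k) ^ m * \<mu> ^ k < (b ^ k) ^ m * ((1 + p ^ k) ^ m * pf_root (q ^ m))"
    using b by (intro mult_strict_left_mono) auto
  moreover have "lam k n ^ k = (b ^ k) ^ m * \<mu> ^ k"
    by (simp add: lam_eq[OF n] m b_def p_def \<mu>_def power_mult_distrib power_mult[symmetric] mult.commute)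
  moreover have "lam k (n + 1) = (b ^ k) ^ m * ((1 + p ^ k) ^ m * pf_root (q ^ m))"
    using n by (simp add: lam_eq m(1) B_Suc_ratio zero_ratio_Suc b_def p_def q_def power_mult_distrib)
  ultimately show ?thesis by simp
qed

text \<open>The strip entropy at \<open>n\<close> uses the eigenvalue at level \<open>n - 1\<close>,
  so the eigenvalue inequality is needed from level -1 on.\<close>

lemma strip_entropy_less:
  assumes k: "k \<ge> 2"
  shows "strip_entropy k n < strip_entropy k (n + 1)"
proof -
  have n: "int n - 1 \<ge> -1" by simp
  have "real k * ln (lam k (int n - 1)) = ln (lam k (int n - 1) ^ k)"
    using lam_pos[OF n, of k] by (simp add: ln_realpow)
  also have "\<dots> < ln (lam k (int n))"
    using lam_power_less[OF n k] lam_pos[OF n, of k] lam_pos[of "int n" k] by simp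
  finally have "real k * ln (lam k (int n - 1)) / real k ^ (n + 1) < ln (lam k (int n)) / real k ^ (n + 1)"
    using k by (intro divide_strict_right_mono) auto
  then show ?thesis
    using k by (simp add: strip_entropy_def)
qed

section \<open>The tree entropy\<close>

text \<open>The quotient of \<open>B k (n + 1)\<close> by \<open>B k n ^ k\<close> is
  \<open>1 + p ^ k\<close>, which lies between 1 and 2.\<close>

lemma ln_B_Suc_bounds:
  assumes "n \<ge> -1"
  shows "k * ln (B k n) \<le> ln (B k (n + 1))" "ln (B k (n + 1)) \<le> k * ln (B k n) + ln 2"
proof -
  define p where "p = zero_ratio k n"
  have p: "0 < p" "p \<le> 1"
    using zero_ratio_pos[OF assms] zero_ratio_le_1[OF assms] by (auto simp: p_def)
  have pk: "0 < p ^ k" "p ^ k \<le> 1" using p by (auto simp: power_le_one)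
  have "ln (B k (n + 1)) = k * ln (B k n) + ln (1 + p ^ k)"
    using B_pos_and_B_root_0_pos[OF assms, of k] pk
    by (simp add: B_Suc_ratio[OF assms] p_def[symmetric] ln_mult ln_realpow)
  then show "k * ln (B k n) \<le> ln (B k (n + 1))" "ln (B k (n + 1)) \<le> k * ln (B k n) + ln 2"
    using pk by auto
qed

lemma B_0: "B k 0 = 2"
  using B_Suc[of "-1" k] by (simp add: B_minus_1 B_root_0_minus_1)

text \<open>In the induction, the extra \<open>ln 2\<close> at each level accounts for the new root
  in \<open>card_Delta_Suc\<close>.\<close>

lemma ln_B_upper: "ln (B k (int n)) \<le> card (Delta k (int n)) * ln 2"
proof (induction n)
  case 0
  show ?case by (simp add: B_0 Delta_0)
next
  case (Suc n)
  have "ln (B k (int n + 1)) \<le> k * ln (B k (int n)) + ln 2"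
    by (rule ln_B_Suc_bounds) simp
  also have "\<dots> \<le> k * (card (Delta k (int n)) * ln 2) + ln 2"
    using Suc by (simp add: mult_left_mono)
  also have "\<dots> = card (Delta k (int n + 1)) * ln 2"
    by (simp add: card_Delta_Suc) (simp add: algebra_simps)
  finally show ?case by (simp add: add.commute)
qed

lemma card_Delta_closed_form: "(real k - 1) * card (Delta k (int n)) = real k ^ (n + 1) - 1"
proof (induction n)
  case 0
  show ?case by (simp add: Delta_0)
next
  case (Suc n)
  have "(real k - 1) * card (Delta k (int n + 1)) =
      real k * ((real k - 1) * card (Delta k (int n))) + (real k - 1)"
    by (simp add: card_Delta_Suc) (simp add: algebra_simps)
  then show ?case
    by (simp add: Suc.IH add.commute) (simp add: algebra_simps)
qed

lemma tree_entropy_bounds: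
  assumes k: "k \<ge> 2"
  shows "(1 - 1 / k) * ln 2 \<le> tree_entropy k" "tree_entropy k \<le> ln 2"
proof -
  \<comment> \<open>Dividing by \<open>k ^ n\<close> instead of the size of the tree makes the
    sequence monotone; the quotient \<open>D\<close> of the two normalizations has the explicit
    limit \<open>k / (k - 1)\<close>.\<close>
  define L where "L n = ln (B k (int n)) / real k ^ n" for n
  define D where "D n = card (Delta k (int n)) / real k ^ n" for n
  have D: "D n = (real k - (1 / real k) ^ n) / (real k - 1)" for n
  proof -
    have "card (Delta k (int n)) = (real k ^ (n + 1) - 1) / (real k - 1)"
      using card_Delta_closed_form[of k n] k by (simp add: eq_divide_eq mult.commute)
    then show ?thesis
      using k by (simp add: D_def diff_divide_distrib power_divide mult.commute)
  qed
  have D_pos: "D n > 0" for n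
  proof -
    have "(1 / real k) ^ n \<le> 1" using k by (intro power_le_one) auto
    then show ?thesis using k by (simp add: D)
  qed
  have D_lim: "D \<longlonglongrightarrow> real k / (real k - 1)"
  proof -
    have "(\<lambda>n. (1 / real k) ^ n) \<longlonglongrightarrow> 0" using k by (intro LIMSEQ_power_zero) auto
    then have "(\<lambda>n. (real k - (1 / real k) ^ n) / (real k - 1)) \<longlonglongrightarrow> (real k - 0) / (real k - 1)"
      using k by (intro tendsto_intros) auto
    then show ?thesis by (simp add: D[abs_def])
  qed
  have "incseq L"
  proof (rule incseq_SucI)
    fix n
    have "k * ln (B k (int n)) / real k ^ Suc n \<le> ln (B k (int n + 1)) / real k ^ Suc n"
      by (intro divide_right_mono ln_B_Suc_bounds) auto
    then show "L n \<le> L (Suc n)" using k by (simp add: L_def add.commute)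
  qed
  have upper: "L n \<le> D n * ln 2" for n
    using divide_right_mono[OF ln_B_upper[of k n], of "real k ^ n"] by (simp add: L_def D_def)
  have "D n \<le> real k / (real k - 1)" for n
    using k by (simp add: D divide_right_mono)
  then have "L n \<le> real k / (real k - 1) * ln 2" for n
    by (meson upper order_trans mult_right_mono ln_ge_zero one_le_numeral)
  \<comment> \<open>Convergence has to be proved before anything can be said about
    \<open>tree_entropy\<close>, which is defined by \<open>lim\<close>.\<close>
  with \<open>incseq L\<close> obtain l where l: "L \<longlonglongrightarrow> l" by (metis incseq_convergent)
  have ratio: "(\<lambda>n. L n / D n) \<longlonglongrightarrow> l / (real k / (real k - 1))"
    using k by (intro tendsto_divide l D_lim) auto
  have "L n / D n = ln (B k (int n)) / card (Delta k (int n))" for n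
    using k by (simp add: L_def D_def)
  with ratio have h: "tree_entropy k = l / (real k / (real k - 1))"
    unfolding tree_entropy_def by (auto intro!: limI)
  show "tree_entropy k \<le> ln 2"
    unfolding h
  proof (rule LIMSEQ_le_const2[OF ratio], intro exI allI impI)
    fix n show "L n / D n \<le> ln 2"
      using upper[of n] D_pos[of n] by (simp add: pos_divide_le_eq mult.commute)
  qed
  \<comment> \<open>The limit of an increasing sequence is at least its first term, here
    \<open>ln (B k 0)\<close> with \<open>B k 0 = 2\<close>.\<close>
  have "ln 2 \<le> l" using incseq_le[OF \<open>incseq L\<close> l, of 0] by (simp add: L_def B_0)
  then have "ln 2 / (real k / (real k - 1)) \<le> l / (real k / (real k - 1))"
    using k by (intro divide_right_mono) auto
  moreover have "ln 2 / (real k / (real k - 1)) = (1 - 1 / k) * ln 2"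
    using k by (simp add: field_simps)
  ultimately show "(1 - 1 / k) * ln 2 \<le> tree_entropy k" by (simp add: h)
qed

lemma tree_entropy_tendsto: "tree_entropy \<longlonglongrightarrow> ln 2"
proof (rule tendsto_sandwich)
  show "\<forall>\<^sub>F k in sequentially. (1 - 1 / real k) * ln 2 \<le> tree_entropy k"
    using tree_entropy_bounds(1) by (auto simp: eventually_sequentially)
  show "\<forall>\<^sub>F k in sequentially. tree_entropy k \<le> ln 2"
    using tree_entropy_bounds(2) by (auto simp: eventually_sequentially)
  have "(\<lambda>k. (1 - 1 / real k) * ln 2) \<longlonglongrightarrow> (1 - 0) * ln 2"
    by (intro tendsto_intros lim_1_over_n)
  then show "(\<lambda>k. (1 - 1 / real k) * ln 2) \<longlonglongrightarrow> ln 2" by simp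
qed simp

theorem theorem4p1:
  shows "(\<forall>k\<in>{2..8::nat}. \<forall>n::nat.
            lam k (int n) ^ k < lam k (int n + 1) \<and>
            strip_entropy k n < strip_entropy k (n + 1)) \<and>
         (\<lambda>k. tree_entropy k) \<longlonglongrightarrow> ln 2"
  using lam_power_less strip_entropy_less tree_entropy_tendsto by simp

end
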